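(* For every integer $N\ge1$ and every $\pi$-integrable function $f:\mathbb{X}\to\mathbb{R}$, $$\int \Pi_N f(x^{1:N})\,\boldsymbol{\pi}_N(\mathrm{d}x^{1:N})=\pi(f).$$
   Context: $(\mathbb{X},\mathcal{X})$ is a measurable space, $\lambda$ is a probability measure on it, and $w:\mathbb{X}\to(0,\infty)$ is a measurable (strictly positive) weight function with $\lambda(w)=\int w\,\mathrm{d}\lambda<\infty$. The target probability measure is $\pi(\mathrm{d}x)=w(x)\lambda(\mathrm{d}x)/\lambda(w)$, and $\pi(f)=\int f\,\mathrm{d}\pi$. Write $x^{1:N}=(x^1,\dots,x^N)\in\mathbb{X}^N$. The self-normalized importance sampling estimator is $$\Pi_N f(x^{1:N})=\sum_{i=1}^N\frac{w(x^i)}{\sum_{\ell=1}^N w(x^\ell)}f(x^i).$$ The probability measure $\boldsymbol{\pi}_N$ on $\mathbb{X}^N$ is $$\boldsymbol{\pi}_N(\mathrm{d}x^{1:N})=\frac{1}{\lambda(w)}\Big(\frac1N\sum_{i=1}^N w(x^i)\Big)\prod_{j=1}^N\lambda(\mathrm{d}x^j).$$ *)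

theory Defs
  imports "HOL-Probability.Probability"
begin

definition is_target :: "'a measure \<Rightarrow> ('a \<Rightarrow> real) \<Rightarrow> 'a measure" where
  "is_target lam w = density lam (\<lambda>x. ennreal (w x / (\<integral>y. w y \<partial>lam)))"

(* Points of the N-fold product are functions x on {1..N}, extended by undefined. *)

definition snis_estimator :: "('a \<Rightarrow> real) \<Rightarrow> nat \<Rightarrow> ('a \<Rightarrow> real) \<Rightarrow> (nat \<Rightarrow> 'a) \<Rightarrow> real" where
  "snis_estimator w N f x = (\<Sum>i=1..N. w (x i) / (\<Sum>l=1..N. w (x l)) * f (x i))"

definition snis_measure :: "'a measure \<Rightarrow> ('a \<Rightarrow> real) \<Rightarrow> nat \<Rightarrow> (nat \<Rightarrow> 'a) measure" where
  "snis_measure lam w N =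
     density (\<Pi>\<^sub>M j\<in>{1..N}. lam)
       (\<lambda>x. ennreal (1 / (\<integral>y. w y \<partial>lam) * (1 / real N * (\<Sum>i=1..N. w (x i)))))"

end

theory Submission
  imports Defs
begin

text \<open>The density of the sampling measure is proportional to the normalizing sum of the estimator,
  so the two cancel and leave the average of \<open>w (x i) * f (x i) / \<lambda>(w)\<close> over the coordinates,
  each of which has law \<open>\<lambda>\<close>.\<close>

text \<open>Since the factors are probability measures, the projection to coordinate
  \<open>i\<close> pushes the product measure forward to \<open>M\<close>; both claims are then a
  change of variables along this projection.\<close>

lemma
  fixes g :: "'a \<Rightarrow> real"
  assumes "prob_space M" "i \<in> I" "integrable M g"
  shows integrable_PiM_coordinate: "integrable (\<Pi>\<^sub>M j\<in>I. M) (\<lambda>x. g (x i))"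
    and integral_PiM_coordinate: "(\<integral>x. g (x i) \<partial>(\<Pi>\<^sub>M j\<in>I. M)) = (\<integral>y. g y \<partial>M)"
proof -
  interpret prob_space M by fact
  interpret P: product_prob_space "\<lambda>_. M" I by unfold_locales
  have distr: "distr (\<Pi>\<^sub>M j\<in>I. M) M (\<lambda>x. x i) = M"
    using P.PiM_component[OF assms(2)] .
  have meas: "(\<lambda>x. x i) \<in> measurable (\<Pi>\<^sub>M j\<in>I. M) M"
    using assms(2) by measurable
  show "integrable (\<Pi>\<^sub>M j\<in>I. M) (\<lambda>x. g (x i))"
    using integrable_distr[OF meas, of g] assms(3) distr by simp
  show "(\<integral>x. g (x i) \<partial>(\<Pi>\<^sub>M j\<in>I. M)) = (\<integral>y. g y \<partial>M)"
    using integral_distr[OF meas, of g] assms(3) distr by simp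
qed

theorem theorem2:
  fixes lam :: "'a measure" and w f :: "'a \<Rightarrow> real" and N :: nat
  assumes "prob_space lam"
    and "w \<in> borel_measurable lam"
    and "\<And>x. x \<in> space lam \<Longrightarrow> w x > 0"
    and "(\<integral>\<^sup>+ x. ennreal (w x) \<partial>lam) < \<infinity>"
    and "N \<ge> 1"
    and "integrable (is_target lam w) f"
  shows "integrable (snis_measure lam w N) (snis_estimator w N f) \<and>
    (\<integral>x. snis_estimator w N f x \<partial>snis_measure lam w N) = (\<integral>x. f x \<partial>is_target lam w)"
proof -
  note [measurable] = assms(2)
  define Z where "Z = (\<integral>y. w y \<partial>lam)"
  define P where "P = (\<Pi>\<^sub>M j\<in>{1..N}. lam)"
  define d where "d x = 1 / Z * (1 / real N * (\<Sum>i=1..N. w (x i)))" for x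
  define g where "g y = w y / Z * f y" for y
  \<comment> \<open>The sign of \<open>Z\<close> makes both densities nonnegative, so that
    \<open>ennreal\<close> does not truncate them. In the cancellation \<open>1 / Z\<close> is only
    carried along as a common factor.\<close>
  have Z: "Z \<ge> 0"
    unfolding Z_def using assms(3) by (intro integral_nonneg_AE AE_I2) (auto intro: less_imp_le)
  have f[measurable]: "f \<in> borel_measurable lam"
    using borel_measurable_integrable[OF assms(6)] by (simp add: is_target_def)
  have nonneg_lam: "AE x in lam. 0 \<le> w x / Z"
    using assms(3) Z by (intro AE_I2) (auto intro!: divide_nonneg_nonneg intro: less_imp_le)
  \<comment> \<open>Moving the density into the integrand turns integrability of \<open>f\<close>
    under the target into integrability of \<open>g\<close> under \<open>lam\<close>, as the
    coordinate lemma requires.\<close>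
  have "integrable lam g"
    using assms(6) unfolding is_target_def g_def Z_def[symmetric]
    by (subst (asm) integrable_density) (use nonneg_lam in auto)
  note g = integrable_PiM_coordinate[OF assms(1) _ this, of _ "{1..N}", folded P_def]
    integral_PiM_coordinate[OF assms(1) _ this, of _ "{1..N}", folded P_def]
  have target: "(\<integral>x. f x \<partial>is_target lam w) = (\<integral>y. g y \<partial>lam)"
    unfolding is_target_def g_def Z_def[symmetric]
    by (subst integral_density) (use nonneg_lam in auto)
  have coord[measurable]: "(\<lambda>x. x i) \<in> measurable P lam" if "i \<in> {1..N}" for i
    unfolding P_def using that by measurable
  have [measurable]: "(\<lambda>x. w (x i)) \<in> borel_measurable P"
    "(\<lambda>x. f (x i)) \<in> borel_measurable P" if "i \<in> {1..N}" for i
    using measurable_compose[OF coord[OF that] assms(2)] measurable_compose[OF coord[OF that] f] .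
  have d_meas[measurable]: "d \<in> borel_measurable P"
    unfolding d_def[abs_def] by measurable
  have est_meas[measurable]: "snis_estimator w N f \<in> borel_measurable P"
    unfolding snis_estimator_def[abs_def] by measurable
  have w_pos: "w (x i) > 0" if "x \<in> space P" "i \<in> {1..N}" for x i
    using assms(3) measurable_space[OF coord] that by blast
  have d_nonneg: "AE x in P. 0 \<le> d x"
    unfolding d_def using Z w_pos
    by (intro AE_I2 mult_nonneg_nonneg sum_nonneg) (auto intro: less_imp_le)
  \<comment> \<open>The random normalizer disappears here: what remains is a sum of functions of one
    coordinate each, so linearity is enough from now on. The identity is confined to
    \<open>space P\<close>, where the weights are known to be positive.\<close>
  have cancel: "d x * snis_estimator w N f x = 1 / real N * (\<Sum>i=1..N. g (x i))"
    if "x \<in> space P" for x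
  proof -
    define S where "S = (\<Sum>i=1..N. w (x i))"
    \<comment> \<open>A sum of positive weights is positive only over a nonempty index set, hence
      the appeal to \<open>N \<ge> 1\<close>.\<close>
    have "S > 0"
      unfolding S_def using assms(5) w_pos[OF that] by (intro sum_pos) auto
    then have "S * snis_estimator w N f x = (\<Sum>i=1..N. w (x i) * f (x i))"
      unfolding snis_estimator_def S_def[symmetric] sum_distrib_left by (intro sum.cong) auto
    then show ?thesis
      unfolding d_def g_def S_def[symmetric] by (simp add: sum_divide_distrib[symmetric] mult.assoc)
  qed
  have "integrable P (\<lambda>x. 1 / real N * (\<Sum>i=1..N. g (x i)))"
    by (intro integrable_mult_right Bochner_Integration.integrable_sum g)
  then have int: "integrable P (\<lambda>x. d x * snis_estimator w N f x)"
    by (subst Bochner_Integration.integrable_cong[OF refl cancel])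
  have "(\<integral>x. d x * snis_estimator w N f x \<partial>P) = (\<integral>x. 1 / real N * (\<Sum>i=1..N. g (x i)) \<partial>P)"
    by (intro Bochner_Integration.integral_cong refl cancel)
  also have "\<dots> = 1 / real N * (\<Sum>i=1..N. \<integral>x. g (x i) \<partial>P)"
    using g(1) by (simp add: Bochner_Integration.integral_sum)
  \<comment> \<open>All \<open>N\<close> summands equal the integral of \<open>g\<close>, and
    \<open>N \<ge> 1\<close> lets the factor \<open>1 / real N\<close> cancel their number.\<close>
  also have "\<dots> = (\<integral>y. g y \<partial>lam)"
    using g(2) assms(5) by simp
  finally have val: "(\<integral>x. d x * snis_estimator w N f x \<partial>P) = (\<integral>y. g y \<partial>lam)" .
  have snis: "snis_measure lam w N = density P (\<lambda>x. ennreal (d x))"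
    unfolding snis_measure_def P_def d_def Z_def ..
  show ?thesis
    unfolding snis target
    using int val integrable_density[OF est_meas d_meas d_nonneg]
      integral_density[OF est_meas d_meas d_nonneg] by simp
qed

end
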